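(* Let $X_1,\dots,X_n$ be Banach spaces satisfying the $c$-Schur property for some $c\ge1$. Let $X=X_1\times\dots\times X_n$ be equipped with a norm $\|\cdot\|$ satisfying $$\max\{\|x_j\|: 1\le j\le n\}\le\|(x_1,\dots,x_n)\|\le\sum_{j=1}^n\|x_j\|,\quad (x_1,\dots,x_n)\in X.$$ Then $X$ satisfies the $nc$-Schur property. Moreover, the factor $n$ is optimal: for each $n\in\mathbb N$ and each $K<n$ there are $c\ge 1$, Banach spaces $X_1,\dots,X_n$ satisfying the $c$-Schur property and a norm on $X_1\times\dots\times X_n$ satisfying the displayed inequalities such that the resulting space fails the $Kc$-Schur property.
   Context: Banach spaces are over a fixed field $\mathbb F\in\{\mathbb R,\mathbb C\}$. For a bounded sequence put $\operatorname{ca}(x_n)=\inf_{n}\operatorname{diam}\{x_k: k\ge n\}$ (also for scalar sequences) and $\delta(x_n)=\sup\{\operatorname{ca}(x^*(x_n)): x^*\in B_{X^*}\}$. A Banach space $X$ has the $c$-Schur property if $\operatorname{ca}(x_n)\le c\,\delta(x_n)$ for each bounded sequence $(x_n)$ in $X$. *)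

theory Defs
  imports Complex_Main "HOL-Library.Function_Algebras"
begin

text \<open>
  A normed space over the scalar field \<open>'f\<close> (used below for \<open>real\<close> and \<open>complex\<close>) is given by a
  linear subspace \<open>V\<close> of some \<open>'f\<close>-vector space, its carrier, and a function \<open>N\<close> whose restriction
  to \<open>V\<close> is a norm; the ambient space carries no norm or topology, and the values of \<open>N\<close> outside
  \<open>V\<close> are irrelevant. This allows families of spaces with different underlying vector spaces:
  finitely many vector spaces are always subspaces of a common one, namely their direct sum.
\<close>

locale normed_space_on = vector_space scale
  for scale :: "'f::real_normed_field \<Rightarrow> 'a::ab_group_add \<Rightarrow> 'a" +
  fixes V :: "'a set" and N :: "'a \<Rightarrow> real"
  assumes subspace_carrier: "subspace V"
    and norm_nonneg: "x \<in> V \<Longrightarrow> 0 \<le> N x"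
    and norm_eq_zero_iff: "x \<in> V \<Longrightarrow> N x = 0 \<longleftrightarrow> x = 0"
    and norm_scale: "x \<in> V \<Longrightarrow> N (scale a x) = norm a * N x"
    and norm_triangle: "x \<in> V \<Longrightarrow> y \<in> V \<Longrightarrow> N (x + y) \<le> N x + N y"

locale banach_space_on = normed_space_on +
  assumes complete_carrier:
    "(\<And>k. x k \<in> V) \<Longrightarrow> (\<And>e. e > 0 \<Longrightarrow> \<exists>m. \<forall>k\<ge>m. \<forall>l\<ge>m. N (x k - x l) < e)
       \<Longrightarrow> \<exists>y\<in>V. (\<lambda>k. N (x k - y)) \<longlonglongrightarrow> 0"

definition diam_on :: "('a::minus \<Rightarrow> real) \<Rightarrow> 'a set \<Rightarrow> real" where
  "diam_on N A = (SUP (x, y) \<in> A \<times> A. N (x - y))"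

text \<open>Only meaningful for \<open>N\<close>-bounded sequences, as suprema are taken in \<open>real\<close>.\<close>

definition ca :: "('a::minus \<Rightarrow> real) \<Rightarrow> (nat \<Rightarrow> 'a) \<Rightarrow> real" where
  "ca N x = (INF n. diam_on N (x ` {n..}))"

text \<open>
  Functionals on \<open>V\<close> are represented by functions on the ambient space, with unspecified values
  outside \<open>V\<close>.
\<close>

definition dual_on ::
    "('f::real_normed_field \<Rightarrow> 'a::ab_group_add \<Rightarrow> 'a) \<Rightarrow> 'a set \<Rightarrow> ('a \<Rightarrow> real) \<Rightarrow> ('a \<Rightarrow> 'f) set" where
  "dual_on scale V N =
     {f. (\<forall>x\<in>V. \<forall>y\<in>V. f (x + y) = f x + f y) \<and> (\<forall>a. \<forall>x\<in>V. f (scale a x) = a * f x) \<and>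
         (\<exists>B. \<forall>x\<in>V. norm (f x) \<le> B * N x)}"

definition dual_norm_on :: "'a set \<Rightarrow> ('a \<Rightarrow> real) \<Rightarrow> ('a \<Rightarrow> 'f::real_normed_field) \<Rightarrow> real" where
  "dual_norm_on V N f = (SUP x \<in> {x \<in> V. N x \<le> 1}. norm (f x))"

definition dual_ball_on ::
    "('f::real_normed_field \<Rightarrow> 'a::ab_group_add \<Rightarrow> 'a) \<Rightarrow> 'a set \<Rightarrow> ('a \<Rightarrow> real) \<Rightarrow> ('a \<Rightarrow> 'f) set" where
  "dual_ball_on scale V N = {f \<in> dual_on scale V N. dual_norm_on V N f \<le> 1}"

definition delta_on ::
    "('f::real_normed_field \<Rightarrow> 'a::ab_group_add \<Rightarrow> 'a) \<Rightarrow> 'a set \<Rightarrow> ('a \<Rightarrow> real) \<Rightarrow> (nat \<Rightarrow> 'a) \<Rightarrow> real" where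
  "delta_on scale V N x = (SUP f \<in> dual_ball_on scale V N. ca norm (\<lambda>k. f (x k)))"

definition bounded_seq_on :: "'a set \<Rightarrow> ('a \<Rightarrow> real) \<Rightarrow> (nat \<Rightarrow> 'a) \<Rightarrow> bool" where
  "bounded_seq_on V N x \<longleftrightarrow> (\<forall>k. x k \<in> V) \<and> (\<exists>B. \<forall>k. N (x k) \<le> B)"

definition schur_property ::
    "real \<Rightarrow> ('f::real_normed_field \<Rightarrow> 'a::ab_group_add \<Rightarrow> 'a) \<Rightarrow> 'a set \<Rightarrow> ('a \<Rightarrow> real) \<Rightarrow> bool" where
  "schur_property c scale V N \<longleftrightarrow>
     (\<forall>x. bounded_seq_on V N x \<longrightarrow> ca N x \<le> c * delta_on scale V N x)"

definition pointwise_scale :: "('f \<Rightarrow> 'a \<Rightarrow> 'a) \<Rightarrow> 'f \<Rightarrow> ('i \<Rightarrow> 'a) \<Rightarrow> 'i \<Rightarrow> 'a" where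
  "pointwise_scale scale a x = (\<lambda>i. scale a (x i))"

text \<open>
  Tuples indexed by \<open>{1..n}\<close> are functions vanishing outside \<open>{1..n}\<close>, so that the product is a
  linear subspace of the functions on \<open>nat\<close> with pointwise operations.
\<close>

definition product_carrier :: "nat \<Rightarrow> (nat \<Rightarrow> 'a::zero set) \<Rightarrow> (nat \<Rightarrow> 'a) set" where
  "product_carrier n V = {x. (\<forall>j\<in>{1..n}. x j \<in> V j) \<and> (\<forall>j. j \<notin> {1..n} \<longrightarrow> x j = 0)}"

definition admissible_product_norm ::
    "nat \<Rightarrow> ('f::real_normed_field \<Rightarrow> 'a::ab_group_add \<Rightarrow> 'a) \<Rightarrow> (nat \<Rightarrow> 'a set) \<Rightarrow> (nat \<Rightarrow> 'a \<Rightarrow> real)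
       \<Rightarrow> ((nat \<Rightarrow> 'a) \<Rightarrow> real) \<Rightarrow> bool" where
  "admissible_product_norm n scale V N M \<longleftrightarrow>
     normed_space_on (pointwise_scale scale) (product_carrier n V) M \<and>
     (\<forall>x\<in>product_carrier n V.
        Max ((\<lambda>j. N j (x j)) ` {1..n}) \<le> M x \<and> M x \<le> (\<Sum>j=1..n. N j (x j)))"

end

theory Submission
  imports Defs "HOL-Complex_Analysis.Great_Picard"
begin

text \<open>
  For the upper bound let \<open>(x\<^sub>k)\<close> be a bounded sequence in the product. As the norm is at most the
  sum of the coordinate norms, \<open>ca(x\<^sub>k)\<close> is at most the sum of the \<open>n\<close> numbers \<open>ca(x\<^sub>k(j))\<close>; the
  \<open>c\<close>-Schur property bounds each of them by \<open>c \<delta>(x\<^sub>k(j))\<close>; and \<open>\<delta>(x\<^sub>k(j)) \<le> \<delta>(x\<^sub>k)\<close> because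
  composing with a coordinate projection maps the dual ball of a factor into the dual ball of the
  product (\<open>schur_property_product\<close>).

  Optimality is attained with \<open>c = 1\<close> and every factor equal to \<open>\<ell>\<^sub>1\<close>, which has the 1-Schur property
  (\<open>schur_property_ell1\<close>). Indeed, if infinitely many differences \<open>z\<^sub>i\<close> of members of a bounded
  sequence, with indices tending to infinity, have norm greater than \<open>s\<close>, one may assume that they
  converge coordinatewise to some \<open>y \<in> \<ell>\<^sub>1\<close>. A gliding hump argument (\<open>gliding_hump\<close>) then gives one
  bounded sequence of modulus at most one which almost norms \<open>y\<close> on an initial segment and almost
  norms infinitely many \<open>z\<^sub>i\<close> on later, pairwise disjoint blocks; as \<open>z\<^sub>i\<close> is close to \<open>y\<close> before its
  block and negligible after it, the corresponding functional almost norms all these \<open>z\<^sub>i\<close>.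

  The product of \<open>n\<close> copies of \<open>\<ell>\<^sub>1\<close> is given the norm
  \<open>M x = max (max\<^sub>j \<parallel>x\<^sub>j\<parallel>) (sup \<Sum>\<^sub>j (\<bar>x\<^sub>j(k)\<bar> + \<bar>x\<^sub>j(l)\<bar>))\<close>, where the supremum is over all \<open>k \<noteq> l\<close>.
  For the sequence \<open>x\<^sub>k = (e\<^sub>k, \<dots>, e\<^sub>k)\<close> of diagonal unit vectors, \<open>M (x\<^sub>k - x\<^sub>l) = 2 n\<close> for \<open>k \<noteq> l\<close>,
  so that \<open>ca(x\<^sub>k) = 2 n\<close>. Nevertheless \<open>\<delta>(x\<^sub>k) \<le> 2\<close> (\<open>delta_on_diagonal_unit_le\<close>): given cluster
  points \<open>a\<close>, \<open>b\<close> of \<open>(f(x\<^sub>k))\<close>, choose disjoint sets \<open>A\<close> and \<open>B\<close> of \<open>n\<close> indices each at which \<open>f(x\<^sub>k)\<close>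
  is close to \<open>a\<close> and \<open>b\<close>, respectively. The vector \<open>\<Sum>\<^sub>A x\<^sub>k - \<Sum>\<^sub>B x\<^sub>k\<close> has norm at most \<open>2 n\<close>: each
  of its \<open>n\<close> coordinates consists of \<open>2 n\<close> entries of modulus one, of which a single term of the
  supremum sees only two. On the other hand, \<open>f\<close> maps it close to \<open>n (a - b)\<close>. Hence \<open>\<bar>a - b\<bar> \<le> 2\<close>.
\<close>

section \<open>The measure of non-Cauchyness and the dual ball\<close>

text \<open>
  Suprema and infima in \<open>ca\<close> and \<open>diam_on\<close> are taken in the reals, so that bounds on all differences
  are needed before \<open>ca\<close> can be compared with anything.
\<close>

context
  fixes N :: "'a::minus \<Rightarrow> real" and x :: "nat \<Rightarrow> 'a" and D :: real
  assumes osc_nonneg: "\<And>k l. 0 \<le> N (x k - x l)" and osc_le: "\<And>k l. N (x k - x l) \<le> D"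
begin

lemma osc_le_diam_on:
  assumes "n \<le> k" "n \<le> l"
  shows "N (x k - x l) \<le> diam_on N (x ` {n..})"
  unfolding diam_on_def
  by (rule cSUP_upper2[where x = "(x k, x l)"]) (use assms osc_le in \<open>auto intro!: bdd_aboveI\<close>)

lemma diam_on_le:
  assumes "\<And>k l. n \<le> k \<Longrightarrow> n \<le> l \<Longrightarrow> N (x k - x l) \<le> s"
  shows "diam_on N (x ` {n..}) \<le> s"
  unfolding diam_on_def by (rule cSUP_least) (use assms in auto)

lemma bdd_below_diam_on: "bdd_below (range (\<lambda>n. diam_on N (x ` {n..})))"
  by (rule bdd_belowI2[where m = 0], rule order_trans[OF osc_nonneg osc_le_diam_on])
     (rule order_refl)+

lemma ca_leI:
  assumes "\<And>k l. n \<le> k \<Longrightarrow> n \<le> l \<Longrightarrow> N (x k - x l) \<le> s"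
  shows "ca N x \<le> s"
  unfolding ca_def by (rule cINF_lower2[OF bdd_below_diam_on UNIV_I diam_on_le[OF assms]])

lemma ca_lessD:
  assumes "ca N x < s"
  obtains n where "\<And>k l. n \<le> k \<Longrightarrow> n \<le> l \<Longrightarrow> N (x k - x l) < s"
proof -
  obtain n where "diam_on N (x ` {n..}) < s"
    using assms bdd_below_diam_on by (auto simp: ca_def cINF_less_iff)
  then show ?thesis using osc_le_diam_on that by (meson le_less_trans)
qed

lemma less_caD:
  assumes "s < ca N x"
  obtains k l where "n \<le> k" "n \<le> l" "s < N (x k - x l)"
  using ca_leI[of n s] assms by (meson not_le)

lemma ca_geI:
  assumes "\<And>n. \<exists>k\<ge>n. \<exists>l\<ge>n. s \<le> N (x k - x l)"
  shows "s \<le> ca N x"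
  by (meson assms ca_lessD not_le)

end

context normed_space_on
begin

lemma zero_in_carrier: "0 \<in> V"
  using subspace_carrier by (rule subspace_0)

lemma add_in_carrier: "x \<in> V \<Longrightarrow> y \<in> V \<Longrightarrow> x + y \<in> V"
  using subspace_carrier by (rule subspace_add)

lemma diff_in_carrier: "x \<in> V \<Longrightarrow> y \<in> V \<Longrightarrow> x - y \<in> V"
  using subspace_carrier by (rule subspace_diff)

lemma scale_in_carrier: "x \<in> V \<Longrightarrow> scale a x \<in> V"
  using subspace_carrier by (rule subspace_scale)

lemma norm_diff_le:
  assumes "x \<in> V" "y \<in> V"
  shows "N (x - y) \<le> N x + N y"
  using norm_triangle[OF assms(1) scale_in_carrier[OF assms(2), of "-1"]]
    norm_scale[OF assms(2), of "-1"] by simp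

lemma bounded_seq_osc:
  assumes "bounded_seq_on V N x"
  obtains D where "\<And>k. x k \<in> V" "\<And>k. N (x k) \<le> D"
    "\<And>k l. 0 \<le> N (x k - x l)" "\<And>k l. N (x k - x l) \<le> 2 * D"
proof -
  obtain D where D: "\<And>k. x k \<in> V" "\<And>k. N (x k) \<le> D"
    using assms by (auto simp: bounded_seq_on_def)
  have "N (x k - x l) \<le> 2 * D" for k l
    using norm_diff_le[OF D(1)[of k] D(1)[of l]] D(2)[of k] D(2)[of l] by linarith
  then show ?thesis
    using that[of D] D norm_nonneg diff_in_carrier by blast
qed

text \<open>
  By \<open>dual_ball_onI\<close> and \<open>dual_ball_on_le\<close>, the dual ball consists of the functionals that are linear
  on the carrier and dominated by the norm there.
\<close>

lemma dual_ball_onI: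
  assumes "\<And>x y. x \<in> V \<Longrightarrow> y \<in> V \<Longrightarrow> f (x + y) = f x + f y"
    and "\<And>a x. x \<in> V \<Longrightarrow> f (scale a x) = a * f x"
    and le: "\<And>x. x \<in> V \<Longrightarrow> norm (f x) \<le> N x"
  shows "f \<in> dual_ball_on scale V N"
proof -
  have "norm (f x) \<le> 1 * N x" if "x \<in> V" for x using le[OF that] by simp
  then have "f \<in> dual_on scale V N"
    unfolding dual_on_def using assms(1,2) by blast
  moreover have "dual_norm_on V N f \<le> 1"
    unfolding dual_norm_on_def
  proof (rule cSUP_least)
    have "N 0 \<le> 1" using norm_eq_zero_iff[OF zero_in_carrier] by simp
    then show "{x \<in> V. N x \<le> 1} \<noteq> {}" using zero_in_carrier by blast
  qed (use le order_trans in blast)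
  ultimately show ?thesis by (simp add: dual_ball_on_def)
qed

lemma dual_ball_on_add: "f \<in> dual_ball_on scale V N \<Longrightarrow> x \<in> V \<Longrightarrow> y \<in> V \<Longrightarrow> f (x + y) = f x + f y"
  by (simp add: dual_ball_on_def dual_on_def)

lemma dual_ball_on_scale: "f \<in> dual_ball_on scale V N \<Longrightarrow> x \<in> V \<Longrightarrow> f (scale a x) = a * f x"
  by (simp add: dual_ball_on_def dual_on_def)

lemma dual_ball_on_zero: "f \<in> dual_ball_on scale V N \<Longrightarrow> f 0 = 0"
  using dual_ball_on_scale[of f 0 0] zero_in_carrier by simp

lemma dual_ball_on_diff:
  assumes "f \<in> dual_ball_on scale V N" "x \<in> V" "y \<in> V"
  shows "f (x - y) = f x - f y"
  using dual_ball_on_add[OF assms(1) assms(2) scale_in_carrier[OF assms(3), of "-1"]]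
    dual_ball_on_scale[OF assms(1,3), of "-1"] by simp

lemma sum_in_carrier: "(\<And>k. k \<in> A \<Longrightarrow> x k \<in> V) \<Longrightarrow> sum x A \<in> V"
  using subspace_carrier by (rule subspace_sum)

lemma dual_ball_on_sum:
  assumes "f \<in> dual_ball_on scale V N" "finite A" "\<And>k. k \<in> A \<Longrightarrow> x k \<in> V"
  shows "f (sum x A) = (\<Sum>k\<in>A. f (x k))"
  using assms(2,3)
  by (induction A rule: finite_induct)
     (auto simp: dual_ball_on_zero[OF assms(1)] dual_ball_on_add[OF assms(1)] sum_in_carrier)

lemma dual_ball_on_le:
  assumes f: "f \<in> dual_ball_on scale V N" and x: "x \<in> V"
  shows "norm (f x) \<le> N x"
proof (cases "x = 0")
  case True
  then show ?thesis using dual_ball_on_zero[OF f] norm_nonneg[OF x] by simp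
next
  case False
  then have pos: "0 < N x"
    using norm_nonneg[OF x] norm_eq_zero_iff[OF x] by linarith
  define y where "y = scale (of_real (inverse (N x))) x"
  have y: "y \<in> V" "N y = 1"
    using pos by (auto simp: y_def scale_in_carrier x norm_scale simp del: of_real_inverse)
  obtain B where B: "\<And>z. z \<in> V \<Longrightarrow> norm (f z) \<le> B * N z"
    using f unfolding dual_ball_on_def dual_on_def by blast
  \<comment> \<open>The supremum in \<open>dual_norm_on\<close> bounds its members only because \<open>f\<close> is a bounded functional.\<close>
  have "bdd_above ((\<lambda>z. norm (f z)) ` {z \<in> V. N z \<le> 1})"
  proof (rule bdd_aboveI2)
    fix z assume "z \<in> {z \<in> V. N z \<le> 1}"
    then have z: "z \<in> V" "N z \<le> 1" by auto
    have "B * N z \<le> \<bar>B\<bar> * 1"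
      using z norm_nonneg by (intro mult_mono) auto
    then show "norm (f z) \<le> \<bar>B\<bar>" using B[OF z(1)] by simp
  qed
  then have "norm (f y) \<le> dual_norm_on V N f"
    unfolding dual_norm_on_def by (rule cSUP_upper[rotated]) (use y in auto)
  then have "norm (f y) \<le> 1" using f by (simp add: dual_ball_on_def)
  then show ?thesis
    using pos by (simp add: y_def dual_ball_on_scale[OF f x] norm_mult norm_divide field_simps)
qed

lemma zero_in_dual_ball_on: "(\<lambda>_. 0) \<in> dual_ball_on scale V N"
  by (rule dual_ball_onI) (auto simp: norm_nonneg)

lemma dual_ball_on_osc_le:
  assumes "f \<in> dual_ball_on scale V N" "\<And>k. x k \<in> V" "\<And>k l. N (x k - x l) \<le> D"
  shows "norm (f (x k) - f (x l)) \<le> D"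
  using dual_ball_on_le[OF assms(1) diff_in_carrier[OF assms(2)[of k] assms(2)[of l]]]
    assms(3)[of k l] dual_ball_on_diff[OF assms(1) assms(2)[of k] assms(2)[of l]] by simp

lemma bdd_above_ca_dual_ball_on:
  assumes "bounded_seq_on V N x"
  shows "bdd_above ((\<lambda>f. ca norm (\<lambda>k. f (x k))) ` dual_ball_on scale V N)"
proof -
  obtain D where D: "\<And>k. x k \<in> V" "\<And>k l. N (x k - x l) \<le> 2 * D"
    using bounded_seq_osc[OF assms] by metis
  show ?thesis
  proof (rule bdd_aboveI2)
    fix f assume "f \<in> dual_ball_on scale V N"
    from dual_ball_on_osc_le[OF this D]
    show "ca norm (\<lambda>k. f (x k)) \<le> 2 * D"
      by (intro ca_leI[where D = "2 * D"]) auto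
  qed
qed

lemma ca_le_delta_on:
  assumes "bounded_seq_on V N x" "f \<in> dual_ball_on scale V N"
  shows "ca norm (\<lambda>k. f (x k)) \<le> delta_on scale V N x"
  unfolding delta_on_def by (rule cSUP_upper[OF assms(2) bdd_above_ca_dual_ball_on[OF assms(1)]])

lemma delta_on_leI:
  assumes "\<And>f. f \<in> dual_ball_on scale V N \<Longrightarrow> ca norm (\<lambda>k. f (x k)) \<le> s"
  shows "delta_on scale V N x \<le> s"
  unfolding delta_on_def by (rule cSUP_least) (use assms zero_in_dual_ball_on in auto)

lemma delta_on_nonneg:
  assumes "bounded_seq_on V N x"
  shows "0 \<le> delta_on scale V N x"
proof -
  have "0 \<le> ca norm (\<lambda>k::nat. 0::'f)"
    by (rule ca_geI[where D = 0]) auto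
  also have "\<dots> \<le> delta_on scale V N x"
    using ca_le_delta_on[OF assms zero_in_dual_ball_on] .
  finally show ?thesis .
qed

end

section \<open>Products of spaces with the Schur property\<close>

lemma admissible_product_norm_le_sum:
  fixes scale :: "'f::real_normed_field \<Rightarrow> 'a::ab_group_add \<Rightarrow> 'a"
  assumes "admissible_product_norm n scale V N M" "x \<in> product_carrier n V"
  shows "M x \<le> (\<Sum>j=1..n. N j (x j))"
  using assms by (simp add: admissible_product_norm_def)

lemma component_le_admissible_product_norm:
  fixes scale :: "'f::real_normed_field \<Rightarrow> 'a::ab_group_add \<Rightarrow> 'a"
  assumes "admissible_product_norm n scale V N M" "x \<in> product_carrier n V" "j \<in> {1..n}"
  shows "N j (x j) \<le> M x"
proof -
  have "N j (x j) \<le> Max ((\<lambda>j. N j (x j)) ` {1..n})"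
    using assms(3) by (intro Max_ge) auto
  then show ?thesis using assms(1,2) by (fastforce simp: admissible_product_norm_def)
qed

text \<open>
  The two estimates behind this are \<open>ca x \<le> \<Sum>j. ca x\<^sub>j\<close>, from the upper bound on the norm, and
  \<open>\<delta> x\<^sub>j \<le> \<delta> x\<close> for each coordinate sequence \<open>x\<^sub>j\<close>, because the lower bound makes every functional
  of norm at most one on the \<open>j\<close>-th factor a functional of norm at most one on the product.
\<close>

lemma schur_property_product:
  fixes scale :: "'f::real_normed_field \<Rightarrow> 'a::ab_group_add \<Rightarrow> 'a"
  assumes n: "n \<ge> 1" and c: "c \<ge> 0"
    and X: "\<And>j. j \<in> {1..n} \<Longrightarrow> normed_space_on scale (V j) (N j)"
    and schur: "\<And>j. j \<in> {1..n} \<Longrightarrow> schur_property c scale (V j) (N j)"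
    and M: "admissible_product_norm n scale V N M"
  shows "schur_property (real n * c) (pointwise_scale scale) (product_carrier n V) M"
proof -
  let ?P = "product_carrier n V"
  let ?s = "pointwise_scale scale"
  interpret P: normed_space_on ?s ?P M
    using M by (simp add: admissible_product_norm_def)
  note upper = admissible_product_norm_le_sum[OF M]
  note comp_le = component_le_admissible_product_norm[OF M]
  have comp: "x j \<in> V j" if "x \<in> ?P" "j \<in> {1..n}" for x j
    using that by (simp add: product_carrier_def)
  show ?thesis
    unfolding schur_property_def
  proof (intro allI impI)
    fix x assume bx: "bounded_seq_on ?P M x"
    obtain D where D: "\<And>k. x k \<in> ?P" "\<And>k. M (x k) \<le> D"
      "\<And>k l. 0 \<le> M (x k - x l)" "\<And>k l. M (x k - x l) \<le> 2 * D"
      using P.bounded_seq_osc[OF bx] by blast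
    let ?d = "delta_on ?s ?P M x"
    have bxj: "bounded_seq_on (V j) (N j) (\<lambda>k. x k j)" if j: "j \<in> {1..n}" for j
      unfolding bounded_seq_on_def
    proof (intro conjI exI allI)
      show "x k j \<in> V j" for k by (rule comp[OF D(1) j])
      show "N j (x k j) \<le> D" for k by (rule order_trans[OF comp_le[OF D(1) j] D(2)])
    qed
    have ca_j: "ca (N j) (\<lambda>k. x k j) \<le> c * ?d" if j: "j \<in> {1..n}" for j
    proof -
      interpret Xj: normed_space_on scale "V j" "N j" by (rule X[OF j])
      have "delta_on scale (V j) (N j) (\<lambda>k. x k j) \<le> ?d"
      proof (rule Xj.delta_on_leI)
        fix f assume f: "f \<in> dual_ball_on scale (V j) (N j)"
        have "(\<lambda>y. f (y j)) \<in> dual_ball_on ?s ?P M"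
          by (rule P.dual_ball_onI)
             (auto simp: Xj.dual_ball_on_add[OF f] Xj.dual_ball_on_scale[OF f] comp[OF _ j]
               pointwise_scale_def
               intro: order_trans[OF Xj.dual_ball_on_le[OF f comp[OF _ j]] comp_le[OF _ j]])
        from P.ca_le_delta_on[OF bx this]
        show "ca norm (\<lambda>k. f (x k j)) \<le> ?d" .
      qed
      with c have "c * delta_on scale (V j) (N j) (\<lambda>k. x k j) \<le> c * ?d"
        by (rule mult_left_mono[rotated])
      moreover have "ca (N j) (\<lambda>k. x k j) \<le> c * delta_on scale (V j) (N j) (\<lambda>k. x k j)"
        using schur[OF j] bxj[OF j] by (simp add: schur_property_def)
      ultimately show ?thesis by linarith
    qed
    have "ca M x \<le> real n * (c * ?d) + e" if e: "e > 0" for e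
    proof -
      have "\<exists>m. \<forall>k\<ge>m. \<forall>l\<ge>m. N j (x k j - x l j) < c * ?d + e / n" if j: "j \<in> {1..n}" for j
      proof -
        interpret Xj: normed_space_on scale "V j" "N j" by (rule X[OF j])
        obtain D' where D': "\<And>k l. 0 \<le> N j (x k j - x l j)" "\<And>k l. N j (x k j - x l j) \<le> D'"
          using Xj.bounded_seq_osc[OF bxj[OF j]] by metis
        have "ca (N j) (\<lambda>k. x k j) < c * ?d + e / n"
        proof -
          have "0 < e / n" using e n by simp
          then show ?thesis using ca_j[OF j] by linarith
        qed
        then obtain m where "\<And>k l. m \<le> k \<Longrightarrow> m \<le> l \<Longrightarrow> N j (x k j - x l j) < c * ?d + e / n"
          using ca_lessD[of "N j" "\<lambda>k. x k j", OF D'] by blast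
        then show ?thesis by blast
      qed
      then obtain m where m: "\<And>j k l. j \<in> {1..n} \<Longrightarrow> m j \<le> k \<Longrightarrow> m j \<le> l \<Longrightarrow>
          N j (x k j - x l j) < c * ?d + e / n"
        by metis
      have "M (x k - x l) \<le> real n * (c * ?d) + e"
        if kl: "Max (m ` {1..n}) \<le> k" "Max (m ` {1..n}) \<le> l" for k l
      proof -
        have "m j \<le> Max (m ` {1..n})" if "j \<in> {1..n}" for j using that by simp
        then have *: "N j ((x k - x l) j) \<le> c * ?d + e / n" if "j \<in> {1..n}" for j
          using m[OF that, of k l] kl that by (fastforce intro: less_imp_le)
        have "M (x k - x l) \<le> (\<Sum>j=1..n. N j ((x k - x l) j))"
          by (rule upper[OF P.diff_in_carrier[OF D(1) D(1)]])
        also have "\<dots> \<le> (\<Sum>j=1..n. c * ?d + e / n)"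
          by (rule sum_mono[OF *])
        also have "\<dots> = real n * (c * ?d) + e" using n by (simp add: field_simps)
        finally show ?thesis .
      qed
      then show ?thesis using ca_leI[of M x, OF D(3,4)] by blast
    qed
    then show "ca M x \<le> real n * c * ?d"
      by (metis field_le_epsilon mult.assoc)
  qed
qed

lemma banach_space_product:
  fixes scale :: "'f::real_normed_field \<Rightarrow> 'a::ab_group_add \<Rightarrow> 'a"
  assumes X: "\<And>j. j \<in> {1..n} \<Longrightarrow> banach_space_on scale (V j) (N j)"
    and M: "admissible_product_norm n scale V N M"
  shows "banach_space_on (pointwise_scale scale) (product_carrier n V) M"
proof -
  let ?P = "product_carrier n V"
  let ?s = "pointwise_scale scale"
  interpret P: normed_space_on ?s ?P M
    using M by (simp add: admissible_product_norm_def)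
  note upper = admissible_product_norm_le_sum[OF M]
  note comp_le = component_le_admissible_product_norm[OF M]
  show ?thesis
  proof (unfold_locales)
    fix x :: "nat \<Rightarrow> nat \<Rightarrow> 'a"
    assume xP: "\<And>k. x k \<in> ?P"
      and cauchy: "\<And>e. e > 0 \<Longrightarrow> \<exists>m. \<forall>k\<ge>m. \<forall>l\<ge>m. M (x k - x l) < e"
    have "\<exists>y\<in>V j. (\<lambda>k. N j (x k j - y)) \<longlonglongrightarrow> 0" if j: "j \<in> {1..n}" for j
    proof (rule banach_space_on.complete_carrier[OF X[OF j]])
      show "x k j \<in> V j" for k using xP[of k] j by (simp add: product_carrier_def)
      show "\<exists>m. \<forall>k\<ge>m. \<forall>l\<ge>m. N j (x k j - x l j) < e" if "e > 0" for e
        using cauchy[OF that] comp_le[OF P.diff_in_carrier[OF xP xP] j]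
        by (metis fun_diff_def le_less_trans)
    qed
    then obtain y0 where y0: "\<And>j. j \<in> {1..n} \<Longrightarrow> y0 j \<in> V j"
      "\<And>j. j \<in> {1..n} \<Longrightarrow> (\<lambda>k. N j (x k j - y0 j)) \<longlonglongrightarrow> 0"
      by metis
    define y where "y = (\<lambda>j. if j \<in> {1..n} then y0 j else 0)"
    have y: "y \<in> ?P" using y0(1) by (auto simp: y_def product_carrier_def)
    have "(\<lambda>k. \<Sum>j=1..n. N j ((x k - y) j)) \<longlonglongrightarrow> (\<Sum>j=1..n. 0)"
      by (rule tendsto_sum) (use y0(2) in \<open>simp add: y_def\<close>)
    then have lim: "(\<lambda>k. \<Sum>j=1..n. N j ((x k - y) j)) \<longlonglongrightarrow> 0" by simp
    have "(\<lambda>k. M (x k - y)) \<longlonglongrightarrow> 0"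
    proof (rule tendsto_sandwich[OF _ _ tendsto_const lim])
      show "\<forall>\<^sub>F k in sequentially. 0 \<le> M (x k - y)"
        by (rule always_eventually) (rule allI, rule P.norm_nonneg[OF P.diff_in_carrier[OF xP y]])
      show "\<forall>\<^sub>F k in sequentially. M (x k - y) \<le> (\<Sum>j=1..n. N j ((x k - y) j))"
        by (rule always_eventually) (rule allI, rule upper[OF P.diff_in_carrier[OF xP y]])
    qed
    then show "\<exists>y\<in>?P. (\<lambda>k. M (x k - y)) \<longlonglongrightarrow> 0" using y by blast
  qed
qed

lemma product_of_schur_spaces:
  fixes scale :: "'f::real_normed_field \<Rightarrow> 'a::ab_group_add \<Rightarrow> 'a"
  assumes "n \<ge> 1" "c \<ge> 1"
    and X: "\<forall>j\<in>{1..n}. banach_space_on scale (V j) (N j) \<and> schur_property c scale (V j) (N j)"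
    and M: "admissible_product_norm n scale V N M"
  shows "banach_space_on (pointwise_scale scale) (product_carrier n V) M \<and>
    schur_property (real n * c) (pointwise_scale scale) (product_carrier n V) M"
proof
  show "banach_space_on (pointwise_scale scale) (product_carrier n V) M"
    by (rule banach_space_product[OF _ M]) (use X in blast)
  show "schur_property (real n * c) (pointwise_scale scale) (product_carrier n V) M"
  proof (rule schur_property_product[OF assms(1) _ _ _ M])
    show "normed_space_on scale (V j) (N j)" if "j \<in> {1..n}" for j
      using X that banach_space_on.axioms(1) by blast
  qed (use assms(2) X in auto)
qed

section \<open>The space of absolutely summable sequences\<close>

text \<open>The space \<open>\<ell>\<^sub>1\<close> over a normed field, as a set of sequences, and its norm.\<close>

definition ell1 :: "(nat \<Rightarrow> 'f::real_normed_field) set" where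
  "ell1 = {x. summable (\<lambda>i. norm (x i))}"

definition ell1_norm :: "(nat \<Rightarrow> 'f::real_normed_field) \<Rightarrow> real" where
  "ell1_norm x = (\<Sum>i. norm (x i))"

lemma vector_space_pointwise_scale:
  fixes scale :: "'f::field \<Rightarrow> 'a::ab_group_add \<Rightarrow> 'a"
  assumes "vector_space scale"
  shows "vector_space (pointwise_scale scale)"
proof -
  interpret vector_space scale by fact
  show ?thesis
    unfolding vector_space_def
    by (auto simp: pointwise_scale_def fun_eq_iff scale_right_distrib scale_left_distrib)
qed

lemma vector_space_pointwise_mult:
  "vector_space (pointwise_scale ((*) :: 'f::field \<Rightarrow> 'f \<Rightarrow> 'f))"
  by (rule vector_space_pointwise_scale) (simp add: vector_space_def algebra_simps)

lemma sum_le_ell1_norm: "x \<in> ell1 \<Longrightarrow> finite A \<Longrightarrow> (\<Sum>i\<in>A. norm (x i)) \<le> ell1_norm x"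
  unfolding ell1_def ell1_norm_def by (intro sum_le_suminf) auto

lemma norm_le_ell1_norm: "x \<in> ell1 \<Longrightarrow> norm (x i) \<le> ell1_norm x"
  using sum_le_ell1_norm[of x "{i}"] by simp

lemma ell1_if_bounded_sums:
  assumes "\<And>n. (\<Sum>i<n. norm (x i)) \<le> B"
  shows "x \<in> ell1" "ell1_norm x \<le> B"
proof -
  show "x \<in> ell1"
    unfolding ell1_def mem_Collect_eq
    by (rule summableI_nonneg_bounded[where x = B]) (use assms in auto)
  then show "ell1_norm x \<le> B"
    unfolding ell1_def ell1_norm_def by (auto intro: suminf_le_const assms)
qed

lemma normed_space_on_ell1:
  "normed_space_on (pointwise_scale (*)) (ell1 :: (nat \<Rightarrow> 'f::real_normed_field) set) ell1_norm"
proof -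
  interpret vector_space "pointwise_scale ((*) :: 'f \<Rightarrow> 'f \<Rightarrow> 'f)"
    by (rule vector_space_pointwise_mult)
  have add: "x + y \<in> ell1 \<and> ell1_norm (x + y) \<le> ell1_norm x + ell1_norm y"
    if "x \<in> ell1" "y \<in> ell1" for x y :: "nat \<Rightarrow> 'f"
  proof -
    have "(\<Sum>i<n. norm ((x + y) i)) \<le> ell1_norm x + ell1_norm y" for n
    proof -
      have "(\<Sum>i<n. norm ((x + y) i)) \<le> (\<Sum>i<n. norm (x i) + norm (y i))"
        by (intro sum_mono) (simp add: norm_triangle_ineq)
      also have "\<dots> \<le> ell1_norm x + ell1_norm y"
        unfolding sum.distrib by (intro add_mono sum_le_ell1_norm that) auto
      finally show ?thesis .
    qed
    then show ?thesis using ell1_if_bounded_sums by blast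
  qed
  show ?thesis
  proof unfold_locales
    show "subspace (ell1 :: (nat \<Rightarrow> 'f) set)"
      using add
      by (auto simp: subspace_def pointwise_scale_def ell1_def norm_mult intro: summable_mult)
    show "0 \<le> ell1_norm x" if "x \<in> ell1" for x :: "nat \<Rightarrow> 'f"
      using that by (auto simp: ell1_def ell1_norm_def intro: suminf_nonneg)
    show "ell1_norm x = 0 \<longleftrightarrow> x = 0" if "x \<in> ell1" for x :: "nat \<Rightarrow> 'f"
      using that suminf_eq_zero_iff[of "\<lambda>i. norm (x i)"]
      by (auto simp: ell1_def ell1_norm_def fun_eq_iff)
    show "ell1_norm (pointwise_scale (*) a x) = norm a * ell1_norm x" if "x \<in> ell1"
      for a and x :: "nat \<Rightarrow> 'f"
      using that by (simp add: ell1_def ell1_norm_def pointwise_scale_def norm_mult suminf_mult)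
  qed (use add in auto)
qed

lemma banach_space_on_ell1:
  "banach_space_on (pointwise_scale (*))
     (ell1 :: (nat \<Rightarrow> 'f::{real_normed_field, complete_space}) set) ell1_norm"
proof -
  interpret L: normed_space_on "pointwise_scale (*)" "ell1 :: (nat \<Rightarrow> 'f) set" ell1_norm
    by (rule normed_space_on_ell1)
  show ?thesis
  proof unfold_locales
    fix x :: "nat \<Rightarrow> nat \<Rightarrow> 'f"
    assume x: "\<And>k. x k \<in> ell1"
      and cauchy: "\<And>e. e > 0 \<Longrightarrow> \<exists>m. \<forall>k\<ge>m. \<forall>l\<ge>m. ell1_norm (x k - x l) < e"
    have "Cauchy (\<lambda>k. x k i)" for i
    proof (rule CauchyI)
      fix e :: real assume "0 < e"
      then obtain m where m: "\<And>k l. m \<le> k \<Longrightarrow> m \<le> l \<Longrightarrow> ell1_norm (x k - x l) < e"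
        using cauchy by blast
      have "norm (x k i - x l i) < e" if "m \<le> k" "m \<le> l" for k l
        using norm_le_ell1_norm[OF L.diff_in_carrier[OF x[of k] x[of l]], of i] m[OF that] by simp
      then show "\<exists>m. \<forall>k\<ge>m. \<forall>l\<ge>m. norm (x k i - x l i) < e" by blast
    qed
    then have y: "(\<lambda>k. x k i) \<longlonglongrightarrow> lim (\<lambda>k. x k i)" for i
      by (intro convergent_LIMSEQ_iff[THEN iffD1] Cauchy_convergent)
    define y where "y i = lim (\<lambda>k. x k i)" for i
    note y = y[folded y_def]
    have close: "\<exists>m. \<forall>k\<ge>m. x k - y \<in> ell1 \<and> ell1_norm (x k - y) \<le> e" if e: "e > 0" for e
    proof -
      obtain m where m: "\<And>k l. m \<le> k \<Longrightarrow> m \<le> l \<Longrightarrow> ell1_norm (x k - x l) < e"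
        using cauchy[OF e] by blast
      have "(\<Sum>i<n. norm ((x k - y) i)) \<le> e" if k: "m \<le> k" for k n
      proof (rule LIMSEQ_le_const2)
        show "(\<lambda>l. \<Sum>i<n. norm (x k i - x l i)) \<longlonglongrightarrow> (\<Sum>i<n. norm ((x k - y) i))"
          by (auto intro!: tendsto_intros y)
        have "(\<Sum>i<n. norm (x k i - x l i)) \<le> e" if "m \<le> l" for l
          using sum_le_ell1_norm[OF L.diff_in_carrier[OF x[of k] x[of l]], of "{..<n}"] m[OF k that]
          by simp
        then show "\<exists>l0. \<forall>l\<ge>l0. (\<Sum>i<n. norm (x k i - x l i)) \<le> e" by blast
      qed
      then show ?thesis using ell1_if_bounded_sums by blast
    qed
    obtain m where m: "x m - y \<in> ell1" using close[of 1] by auto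
    have "x m - (x m - y) \<in> ell1" by (rule L.diff_in_carrier[OF x m])
    then have "y \<in> ell1" by simp
    moreover have "(\<lambda>k. ell1_norm (x k - y)) \<longlonglongrightarrow> 0"
    proof (rule LIMSEQ_I)
      fix e :: real assume "0 < e"
      then obtain m where m: "\<forall>k\<ge>m. ell1_norm (x k - y) \<le> e / 2"
        using close[of "e / 2"] by auto
      have "norm (ell1_norm (x k - y) - 0) < e" if "m \<le> k" for k
        using m that \<open>0 < e\<close> L.norm_nonneg[OF L.diff_in_carrier[OF x[of k] \<open>y \<in> ell1\<close>]]
        by fastforce
      then show "\<exists>m. \<forall>k\<ge>m. norm (ell1_norm (x k - y) - 0) < e" by blast
    qed
    ultimately show "\<exists>y\<in>ell1. (\<lambda>k. ell1_norm (x k - y)) \<longlonglongrightarrow> 0" by blast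
  qed
qed

lemma norm_mult_le_right:
  fixes a b :: "'f::real_normed_algebra"
  assumes "norm a \<le> 1"
  shows "norm (a * b) \<le> norm b"
  by (rule order_trans[OF norm_mult_ineq]) (rule mult_left_le_one_le[OF norm_ge_zero norm_ge_zero assms])

lemma summable_pairing:
  fixes f x :: "nat \<Rightarrow> 'f::{real_normed_field, banach}"
  assumes "\<And>i. norm (f i) \<le> 1" "x \<in> ell1"
  shows "summable (\<lambda>i. norm (f i * x i))"
proof (rule summable_comparison_test'[where N = 0])
  show "summable (\<lambda>i. norm (x i))" using assms(2) by (simp add: ell1_def)
  show "norm (norm (f i * x i)) \<le> norm (x i)" for i
    using norm_mult_le_right[OF assms(1)] by simp
qed

text \<open>
  Only these functionals on \<open>\<ell>\<^sub>1\<close> are needed; that they exhaust its dual ball plays no role.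
\<close>

lemma pairing_in_dual_ball_ell1:
  fixes f :: "nat \<Rightarrow> 'f::{real_normed_field, banach}"
  assumes f: "\<And>i. norm (f i) \<le> 1"
  shows "(\<lambda>x. \<Sum>i. f i * x i) \<in> dual_ball_on (pointwise_scale (*)) ell1 ell1_norm"
proof -
  interpret L: normed_space_on "pointwise_scale (*)" "ell1 :: (nat \<Rightarrow> 'f) set" ell1_norm
    by (rule normed_space_on_ell1)
  note sm = summable_pairing[OF f]
  show ?thesis
  proof (rule L.dual_ball_onI)
    show "(\<Sum>i. f i * (x + y) i) = (\<Sum>i. f i * x i) + (\<Sum>i. f i * y i)"
      if "x \<in> ell1" "y \<in> ell1" for x y
      using sm[OF that(1)] sm[OF that(2)]
      by (simp add: distrib_left suminf_add summable_norm_cancel)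
    show "(\<Sum>i. f i * pointwise_scale (*) a x i) = a * (\<Sum>i. f i * x i)" if "x \<in> ell1" for a x
      using suminf_mult[OF summable_norm_cancel[OF sm[OF that]], of a]
      by (simp add: pointwise_scale_def mult.left_commute)
    show "norm (\<Sum>i. f i * x i) \<le> ell1_norm x" if "x \<in> ell1" for x
    proof -
      have "norm (\<Sum>i. f i * x i) \<le> (\<Sum>i. norm (f i * x i))"
        by (rule summable_norm[OF sm[OF that]])
      also have "\<dots> \<le> ell1_norm x"
        unfolding ell1_norm_def
        by (rule suminf_le[OF norm_mult_le_right[OF f] sm[OF that]])
           (use that in \<open>simp add: ell1_def\<close>)
      finally show ?thesis .
    qed
  qed
qed

lemma sums_tail:
  fixes u :: "nat \<Rightarrow> 'a::real_normed_vector"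
  assumes "summable u"
  shows "(\<lambda>j. if p \<le> j then u j else 0) sums (\<Sum>j. u (j + p))"
proof -
  have "(\<lambda>j. if p \<le> j + p then u (j + p) else 0) sums (\<Sum>j. u (j + p))"
    using summable_ignore_initial_segment[OF assms, of p] by (simp add: summable_sums)
  then show ?thesis
    by (subst (asm) sums_iff_shift) simp
qed

text \<open>
  If \<open>z\<^sub>i\<close> converges to \<open>y\<close> coordinatewise in \<open>\<ell>\<^sub>1\<close>, a single functional of norm at most one almost
  attains the norm of \<open>z\<^sub>i\<close> for infinitely many \<open>i\<close>.
\<close>

lemma gliding_hump:
  fixes z :: "nat \<Rightarrow> nat \<Rightarrow> 'f::{real_normed_field, banach}"
  assumes z: "\<And>i. z i \<in> ell1" and y: "y \<in> ell1" and lim: "\<And>j. (\<lambda>i. z i j) \<longlonglongrightarrow> y j"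
    and e: "e > 0"
  obtains f I where "\<And>j. norm (f j) \<le> 1" "\<And>m::nat. m \<le> I m"
    "\<And>m. ell1_norm (z (I m)) - e \<le> norm (\<Sum>j. f j * z (I m) j)"
proof -
  \<comment> \<open>Three error terms, each smaller than \<open>d\<close> and counted twice, have to add up to at most \<open>e\<close>.\<close>
  define d where "d = e / 6"
  have d: "d > 0" using e by (simp add: d_def)
  obtain p where p: "(\<Sum>j. norm (y (j + p))) < d"
  proof -
    obtain p where "norm (\<Sum>j. norm (y (j + p))) < d"
      using suminf_exist_split[OF d, of "\<lambda>j. norm (y j)"] y by (auto simp: ell1_def)
    then show thesis by (intro that[of p]) (simp add: abs_less_iff)
  qed
  have "\<exists>i\<ge>q. (\<Sum>j<q. norm (z i j - y j)) < d" for q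
  proof -
    have "(\<lambda>i. \<Sum>j<q. norm (z i j - y j)) \<longlonglongrightarrow> (\<Sum>j<q. norm (y j - y j))"
      by (intro tendsto_intros lim)
    then have "\<forall>\<^sub>F i in sequentially. (\<Sum>j<q. norm (z i j - y j)) < d"
      using d by (intro order_tendstoD(2)) auto
    from eventually_conj[OF this eventually_ge_at_top[of q]] show ?thesis
      by (auto simp: eventually_sequentially)
  qed
  then obtain I0 where I0: "\<And>q. q \<le> I0 q" "\<And>q. (\<Sum>j<q. norm (z (I0 q) j - y j)) < d"
    by metis
  have "\<exists>q'>q. (\<Sum>j. norm (z (I0 q) (j + q'))) < d" for q
  proof -
    obtain q0 where "\<forall>q'\<ge>q0. norm (\<Sum>j. norm (z (I0 q) (j + q'))) < d"
      using suminf_exist_split[OF d, of "\<lambda>j. norm (z (I0 q) j)"] z[of "I0 q"]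
      by (auto simp: ell1_def)
    then have "norm (\<Sum>j. norm (z (I0 q) (j + max q0 (Suc q)))) < d" by simp
    then show ?thesis by (intro exI[of _ "max q0 (Suc q)"]) auto
  qed
  then obtain Q0 where Q0: "\<And>q. q < Q0 q" "\<And>q. (\<Sum>j. norm (z (I0 q) (j + Q0 q))) < d"
    by metis
  \<comment> \<open>The blocks are the intervals from \<open>q m\<close> to \<open>q (Suc m)\<close>. With \<open>i = I0 (q m)\<close>, the sequence \<open>z i\<close>
      is close to \<open>y\<close> before the block and small after it.\<close>
  define q where "q m = (Q0 ^^ m) p" for m
  have q_Suc: "q (Suc m) = Q0 (q m)" for m by (simp add: q_def)
  have q_mono: "strict_mono q"
    by (rule strict_monoI_Suc) (simp add: q_Suc Q0)
  have q_ge: "m \<le> q m" "p \<le> q m" for m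
    using strict_mono_imp_increasing[OF q_mono] strict_mono_less_eq[OF q_mono, of 0 m]
    by (auto simp: q_def)
  define block where "block j = (LEAST m. j < q (Suc m))" for j
  have block: "block j = m" if j: "q m \<le> j" "j < q (Suc m)" for j m
    unfolding block_def
  proof (rule Least_equality)
    show "j < q (Suc m)" by (rule j)
    show "m \<le> m'" if "j < q (Suc m')" for m'
      using strict_mono_less[OF q_mono, of m "Suc m'"] that j(1) by linarith
  qed
  \<comment> \<open>For \<open>t = 0\<close> the quotient is \<open>0\<close>, and both properties of \<open>sg\<close> still hold.\<close>
  define sg :: "'f \<Rightarrow> 'f" where "sg t = of_real (norm t) / t" for t
  have sg: "sg t * t = of_real (norm t)" "norm (sg t) \<le> 1" for t
    by (auto simp: sg_def norm_divide)
  define f where "f j = (if j < p then sg (y j) else sg (z (I0 (q (block j))) j))" for j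
  have f: "norm (f j) \<le> 1" for j by (simp add: f_def sg)
  have "ell1_norm (z (I0 (q m))) - e \<le> norm (\<Sum>j. f j * z (I0 (q m)) j)" for m
  proof -
    let ?z = "z (I0 (q m))"
    let ?g = "\<lambda>j. f j * ?z j - of_real (norm (?z j))"
    \<comment> \<open>The sum of these three sequences dominates half the distance of \<open>f j * ?z j\<close> from \<open>\<bar>?z j\<bar>\<close>. Before \<open>p\<close> the sign
        of \<open>y j\<close> replaces that of \<open>?z j\<close>, which costs \<open>2 * h1 j\<close>; between \<open>p\<close> and the block \<open>?z j\<close> is small
        because it is close to \<open>y j\<close>; on the block there is no loss.\<close>
    define h1 where "h1 = (\<lambda>j. if j \<in> {..<q m} then norm (?z j - y j) else 0)"
    define h2 where "h2 = (\<lambda>j. if p \<le> j then norm (y j) else 0)"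
    define h3 where "h3 = (\<lambda>j. if q (Suc m) \<le> j then norm (?z j) else 0)"
    have h1: "h1 sums (\<Sum>j<q m. norm (?z j - y j))"
      unfolding h1_def by (rule sums_If_finite_set) simp
    have h2: "h2 sums (\<Sum>j. norm (y (j + p)))"
      unfolding h2_def by (rule sums_tail) (use y in \<open>simp add: ell1_def\<close>)
    have h3: "h3 sums (\<Sum>j. norm (?z (j + q (Suc m))))"
      unfolding h3_def by (rule sums_tail) (use z in \<open>simp add: ell1_def\<close>)
    define G where "G j = norm (?g j)" for j
    have fz: "G j \<le> 2 * norm (?z j)" for j
    proof -
      have "norm (?g j) \<le> norm (f j * ?z j) + norm (of_real (norm (?z j)) :: 'f)"
        by (rule norm_triangle_ineq4)
      then show ?thesis using norm_mult_le_right[OF f[of j], of "?z j"] by (simp add: G_def)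
    qed
    have "G j \<le> 2 * h1 j + 2 * h2 j + 2 * h3 j" for j
    proof -
      have nn: "0 \<le> h1 j" "0 \<le> h2 j" "0 \<le> h3 j" by (auto simp: h1_def h2_def h3_def)
      consider "j < p" | "p \<le> j" "j < q m" | "q m \<le> j" "j < q (Suc m)" | "q (Suc m) \<le> j"
        by linarith
      then show ?thesis
      proof cases
        case 1
        have "?g j = sg (y j) * (?z j - y j) + of_real (norm (y j) - norm (?z j))"
          using 1 sg(1)[of "y j"] by (simp add: f_def algebra_simps)
        then have "G j \<le> norm (sg (y j) * (?z j - y j)) + \<bar>norm (y j) - norm (?z j)\<bar>"
          unfolding G_def by (metis norm_of_real norm_triangle_ineq)
        moreover have "norm (sg (y j) * (?z j - y j)) \<le> norm (?z j - y j)"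
          by (rule norm_mult_le_right[OF sg(2)])
        moreover have "\<bar>norm (y j) - norm (?z j)\<bar> \<le> norm (?z j - y j)"
          by (metis norm_minus_commute norm_triangle_ineq3)
        ultimately have "G j \<le> norm (?z j - y j) + norm (?z j - y j)"
          by (meson add_mono order_trans)
        also have "norm (?z j - y j) = h1 j"
          using 1 q_ge(2)[of m] by (simp add: h1_def)
        finally show ?thesis using nn by linarith
      next
        case 2
        then have "h1 j = norm (?z j - y j)" "h2 j = norm (y j)" by (auto simp: h1_def h2_def)
        moreover have "norm (?z j) \<le> norm (?z j - y j) + norm (y j)"
          using norm_triangle_ineq[of "?z j - y j" "y j"] by simp
        ultimately show ?thesis using fz[of j] nn by linarith
      next
        case 3
        then have "f j = sg (?z j)"
          using q_ge(2)[of m] block[OF 3] by (simp add: f_def)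
        then show ?thesis using nn by (simp add: G_def sg)
      next
        case 4
        then have "h3 j = norm (?z j)" by (simp add: h3_def)
        then show ?thesis using fz[of j] nn by linarith
      qed
    qed
    then have le: "norm (?g j) \<le> 2 * h1 j + 2 * h2 j + 2 * h3 j" for j by (simp add: G_def)
    have h: "(\<lambda>j. 2 * h1 j + 2 * h2 j + 2 * h3 j) sums (2 * (\<Sum>j<q m. norm (?z j - y j))
        + 2 * (\<Sum>j. norm (y (j + p))) + 2 * (\<Sum>j. norm (?z (j + q (Suc m)))))"
      by (intro sums_mult sums_add h1 h2 h3)
    have sg_norm: "summable (\<lambda>j. norm (?g j))"
      by (rule summable_comparison_test'[OF sums_summable[OF h], of 0]) (use le in simp)
    have "norm (suminf ?g) \<le> (\<Sum>j. norm (?g j))" by (rule summable_norm[OF sg_norm])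
    also have "\<dots> \<le> (\<Sum>j. 2 * h1 j + 2 * h2 j + 2 * h3 j)"
      by (rule suminf_le[OF le sg_norm sums_summable[OF h]])
    also have "\<dots> = 2 * (\<Sum>j<q m. norm (?z j - y j))
        + 2 * (\<Sum>j. norm (y (j + p))) + 2 * (\<Sum>j. norm (?z (j + q (Suc m))))"
      by (rule sums_unique[OF h, symmetric])
    also have "\<dots> \<le> e"
      using I0(2)[of "q m"] p Q0(2)[of "q m"] unfolding q_Suc d_def by linarith
    finally have small: "norm (suminf ?g) \<le> e" .
    have sz: "summable (\<lambda>j. norm (?z j))" using z by (simp add: ell1_def)
    have "suminf ?g = (\<Sum>j. f j * ?z j) - (\<Sum>j. of_real (norm (?z j)))"
      by (rule suminf_diff[symmetric])
         (auto intro: summable_norm_cancel[OF summable_pairing[OF f z]] summable_of_real[OF sz])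
    also have "(\<Sum>j. of_real (norm (?z j))) = (of_real (ell1_norm ?z) :: 'f)"
      unfolding ell1_norm_def by (rule suminf_of_real[OF sz, symmetric])
    finally have "norm (of_real (ell1_norm ?z) - (\<Sum>j. f j * ?z j)) \<le> e"
      using small by (metis norm_minus_commute)
    then have "norm (of_real (ell1_norm ?z) :: 'f) - norm (\<Sum>j. f j * ?z j) \<le> e"
      using norm_triangle_ineq2 order_trans by blast
    then show ?thesis by simp
  qed
  moreover have "m \<le> I0 (q m)" for m
    using q_ge(1)[of m] I0(1)[of "q m"] by linarith
  ultimately show ?thesis by (rule that[of f "\<lambda>m. I0 (q m)", OF f, rotated])
qed

text \<open>
  The field is assumed to satisfy the Heine-Borel property in order to pass to a coordinatewise
  convergent subsequence; this covers the real and the complex numbers.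
\<close>

lemma schur_property_ell1:
  "schur_property 1 (pointwise_scale (*))
     (ell1 :: (nat \<Rightarrow> 'f::{real_normed_field, banach, heine_borel}) set) ell1_norm"
  unfolding schur_property_def
proof (intro allI impI)
  fix x :: "nat \<Rightarrow> nat \<Rightarrow> 'f"
  let ?s = "pointwise_scale (*) :: 'f \<Rightarrow> (nat \<Rightarrow> 'f) \<Rightarrow> nat \<Rightarrow> 'f"
  interpret L: normed_space_on ?s "ell1 :: (nat \<Rightarrow> 'f) set" ell1_norm
    by (rule normed_space_on_ell1)
  assume bx: "bounded_seq_on ell1 ell1_norm x"
  obtain D where D: "\<And>k. x k \<in> ell1" "\<And>k l. 0 \<le> ell1_norm (x k - x l)"
    "\<And>k l. ell1_norm (x k - x l) \<le> 2 * D"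
    using L.bounded_seq_osc[OF bx] by metis
  have "s \<le> delta_on ?s ell1 ell1_norm x" if s: "s < ca ell1_norm x" for s
  proof -
    have "\<exists>k\<ge>i. \<exists>l\<ge>i. s < ell1_norm (x k - x l)" for i
      using less_caD[of ell1_norm x, OF D(2,3) s] by metis
    then obtain kk ll where kl: "\<And>i. i \<le> kk i" "\<And>i. i \<le> ll i"
      "\<And>i. s < ell1_norm (x (kk i) - x (ll i))"
      by metis
    define w where "w i = x (kk i) - x (ll i)" for i
    have w: "w i \<in> ell1" "ell1_norm (w i) \<le> 2 * D" for i
      by (auto simp: w_def D L.diff_in_carrier)
    have "norm (w i j) \<le> 2 * D" for i j
      using norm_le_ell1_norm[OF w(1)] w(2) order_trans by blast
    then obtain r :: "nat \<Rightarrow> nat" where r: "strict_mono r"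
      "\<And>j. \<exists>l. (\<lambda>i. w (r i) j) \<longlonglongrightarrow> l"
      using function_convergent_subsequence[of "UNIV :: nat set" w "2 * D"]
      by (metis UNIV_I countableI_type)
    then obtain y where y: "\<And>j. (\<lambda>i. w (r i) j) \<longlonglongrightarrow> y j" by metis
    have "(\<Sum>j<n. norm (y j)) \<le> 2 * D" for n
    proof (rule LIMSEQ_le_const2)
      show "(\<lambda>i. \<Sum>j<n. norm (w (r i) j)) \<longlonglongrightarrow> (\<Sum>j<n. norm (y j))"
        by (intro tendsto_intros y)
      show "\<exists>i0. \<forall>i\<ge>i0. (\<Sum>j<n. norm (w (r i) j)) \<le> 2 * D"
        using sum_le_ell1_norm[OF w(1), of "{..<n}"] w(2) order_trans by blast
    qed
    then have y_ell1: "y \<in> ell1" by (rule ell1_if_bounded_sums)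
    show ?thesis
    proof (rule field_le_epsilon)
      fix e :: real assume "0 < e"
      obtain f I where f: "\<And>j. norm (f j) \<le> 1" and I: "\<And>m::nat. m \<le> I m"
        and hump: "\<And>m. ell1_norm (w (r (I m))) - e \<le> norm (\<Sum>j. f j * w (r (I m)) j)"
        using gliding_hump[of "\<lambda>i. w (r i)", OF w(1) y_ell1 y \<open>0 < e\<close>] by metis
      define F where "F = (\<lambda>u. \<Sum>j. f j * u j)"
      have F: "F \<in> dual_ball_on ?s ell1 ell1_norm"
        unfolding F_def by (rule pairing_in_dual_ball_ell1[OF f])
      have "s - e \<le> ca norm (\<lambda>k. F (x k))"
      proof (rule ca_geI)
        show "norm (F (x k) - F (x l)) \<le> 2 * D" for k l
          by (rule L.dual_ball_on_osc_le[OF F D(1,3)])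
        fix n
        let ?i = "r (I n)"
        have "n \<le> ?i"
          using I[of n] strict_mono_imp_increasing[OF r(1), of "I n"] by linarith
        then have "n \<le> kk ?i" "n \<le> ll ?i" using kl(1,2)[of ?i] by auto
        moreover have "s - e \<le> norm (F (x (kk ?i)) - F (x (ll ?i)))"
          using hump[of n] kl(3)[of ?i] L.dual_ball_on_diff[OF F D(1) D(1)]
          by (simp add: w_def F_def)
        ultimately show "\<exists>k\<ge>n. \<exists>l\<ge>n. s - e \<le> norm (F (x k) - F (x l))" by blast
      qed simp
      also have "\<dots> \<le> delta_on ?s ell1 ell1_norm x"
        by (rule L.ca_le_delta_on[OF bx F])
      finally show "s \<le> delta_on ?s ell1 ell1_norm x + e" by simp
    qed
  qed
  then show "ca ell1_norm x \<le> 1 * delta_on ?s ell1 ell1_norm x"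
    using dense_le by (metis mult_1)
qed

section \<open>Optimality of the factor\<close>

text \<open>
  The seminorms on the \<open>n\<close>-th power of \<open>\<ell>\<^sub>1\<close> whose pointwise supremum is the norm that shows
  optimality: the \<open>\<ell>\<^sub>1\<close>-norms of the coordinates, and for each pair of positions the sum of the moduli
  of all coordinates at these two positions.
\<close>

definition spread_seminorms :: "nat \<Rightarrow> ((nat \<Rightarrow> nat \<Rightarrow> 'f::real_normed_field) \<Rightarrow> real) set" where
  "spread_seminorms n =
     (\<lambda>j x. ell1_norm (x j)) ` {1..n} \<union>
     (\<lambda>A x. \<Sum>j=1..n. \<Sum>i\<in>A. norm (x j i)) ` {A. card A = 2}"

text \<open>
  The norm itself. The supremum is a real one; on the \<open>n\<close>-th power of \<open>\<ell>\<^sub>1\<close> it is bounded by the sum of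
  the coordinate norms.
\<close>

definition spread_norm :: "nat \<Rightarrow> (nat \<Rightarrow> nat \<Rightarrow> 'f::real_normed_field) \<Rightarrow> real" where
  "spread_norm n x = (SUP p \<in> spread_seminorms n. p x)"

text \<open>The carrier of the product of \<open>n\<close> copies of \<open>\<ell>\<^sub>1\<close>.\<close>

abbreviation ell1_power :: "nat \<Rightarrow> (nat \<Rightarrow> nat \<Rightarrow> 'f::real_normed_field) set" where
  "ell1_power n \<equiv> product_carrier n (\<lambda>_. ell1)"

lemma spread_seminorms_cases:
  assumes "p \<in> spread_seminorms n"
  obtains (coordinate) j where "j \<in> {1..n}" "p = (\<lambda>x. ell1_norm (x j))"
  | (pair) A where "finite A" "card A = 2" "p = (\<lambda>x. \<Sum>j=1..n. \<Sum>i\<in>A. norm (x j i))"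
  using assms unfolding spread_seminorms_def by (force simp: card_ge_0_finite)

lemma ell1_power_component: "x \<in> ell1_power n \<Longrightarrow> j \<in> {1..n} \<Longrightarrow> x j \<in> ell1"
  by (simp add: product_carrier_def)

lemma spread_seminorm_le_sum:
  assumes "p \<in> spread_seminorms n" "x \<in> ell1_power n"
  shows "p x \<le> (\<Sum>j=1..n. ell1_norm (x j))"
  using assms(1)
proof (cases rule: spread_seminorms_cases)
  case (coordinate j)
  have "0 \<le> ell1_norm (x k)" if "k \<in> {1..n}" for k
    by (rule normed_space_on.norm_nonneg[OF normed_space_on_ell1 ell1_power_component[OF assms(2) that]])
  then show ?thesis using coordinate by (auto intro: member_le_sum)
next
  case (pair A)
  then show ?thesis
    using ell1_power_component[OF assms(2)] by (auto intro!: sum_mono sum_le_ell1_norm)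
qed

lemma spread_seminorm_le_spread_norm:
  assumes "p \<in> spread_seminorms n" "x \<in> ell1_power n"
  shows "p x \<le> spread_norm n x"
  unfolding spread_norm_def
  by (rule cSUP_upper[OF assms(1) bdd_aboveI2]) (rule spread_seminorm_le_sum[OF _ assms(2)])

lemma spread_norm_leI:
  assumes "\<And>p. p \<in> spread_seminorms n \<Longrightarrow> p x \<le> s"
  shows "spread_norm n x \<le> s"
proof -
  have "{0, 1::nat} \<in> {A. card A = 2}" by simp
  then have "spread_seminorms n \<noteq> {}"
    unfolding spread_seminorms_def by blast
  then show ?thesis unfolding spread_norm_def by (rule cSUP_least[OF _ assms])
qed

lemma spread_norm_le_sum:
  "x \<in> ell1_power n \<Longrightarrow> spread_norm n x \<le> (\<Sum>j=1..n. ell1_norm (x j))"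
  by (rule spread_norm_leI[OF spread_seminorm_le_sum])

lemma ell1_norm_le_spread_norm:
  "x \<in> ell1_power n \<Longrightarrow> j \<in> {1..n} \<Longrightarrow> ell1_norm (x j) \<le> spread_norm n x"
  using spread_seminorm_le_spread_norm[of "\<lambda>x. ell1_norm (x j)" n x]
  by (auto simp: spread_seminorms_def)

lemma spread_seminorm_triangle:
  assumes "p \<in> spread_seminorms n" "x \<in> ell1_power n" "y \<in> ell1_power n"
  shows "p (x + y) \<le> p x + p y"
  using assms(1)
proof (cases rule: spread_seminorms_cases)
  case (coordinate j)
  have "x j \<in> ell1" "y j \<in> ell1"
    using coordinate(1) assms(2,3) by (auto intro: ell1_power_component)
  from normed_space_on.norm_triangle[OF normed_space_on_ell1 this]
  show ?thesis by (simp add: coordinate)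
next
  case (pair A)
  then show ?thesis
    by (simp add: sum.distrib[symmetric] sum_mono norm_triangle_ineq)
qed

lemma spread_seminorm_scale:
  assumes "p \<in> spread_seminorms n" "x \<in> ell1_power n"
  shows "p (pointwise_scale (pointwise_scale (*)) a x) = norm a * p x"
  using assms(1)
proof (cases rule: spread_seminorms_cases)
  case (coordinate j)
  with normed_space_on.norm_scale[OF normed_space_on_ell1 ell1_power_component[OF assms(2)]]
  show ?thesis by (simp add: pointwise_scale_def)
next
  case (pair A)
  then show ?thesis
    by (simp add: pointwise_scale_def norm_mult sum_distrib_left)
qed

lemma normed_space_on_spread_norm:
  assumes n: "n \<ge> 1"
  shows "normed_space_on (pointwise_scale (pointwise_scale (*)))
    (ell1_power n :: (nat \<Rightarrow> nat \<Rightarrow> 'f::real_normed_field) set) (spread_norm n)"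
proof -
  let ?s = "pointwise_scale (pointwise_scale (*)) :: 'f \<Rightarrow> (nat \<Rightarrow> nat \<Rightarrow> 'f) \<Rightarrow> nat \<Rightarrow> nat \<Rightarrow> 'f"
  let ?P = "ell1_power n :: (nat \<Rightarrow> nat \<Rightarrow> 'f) set"
  interpret L: normed_space_on "pointwise_scale (*)" "ell1 :: (nat \<Rightarrow> 'f) set" ell1_norm
    by (rule normed_space_on_ell1)
  interpret P: vector_space ?s
    by (intro vector_space_pointwise_scale vector_space_pointwise_mult)
  have scale_P: "?s a x \<in> ?P" if "x \<in> ?P" for a x
    using that L.scale_in_carrier by (auto simp: product_carrier_def pointwise_scale_def fun_eq_iff)
  have nonneg: "0 \<le> spread_norm n x" if "x \<in> ?P" for x
    using ell1_norm_le_spread_norm[OF that, of 1] L.norm_nonneg[OF ell1_power_component[OF that, of 1]] n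
    by simp
  have scale_le: "spread_norm n (?s a x) \<le> norm a * spread_norm n x" if "x \<in> ?P" for a x
    by (rule spread_norm_leI)
       (simp add: spread_seminorm_scale[OF _ that] mult_left_mono
         spread_seminorm_le_spread_norm[OF _ that])
  show ?thesis
  proof unfold_locales
    show "P.subspace ?P"
      using scale_P L.add_in_carrier L.zero_in_carrier
      by (auto simp: P.subspace_def) (auto simp: product_carrier_def)
    fix x assume x: "x \<in> ?P"
    show "0 \<le> spread_norm n x" by (rule nonneg[OF x])
    show "spread_norm n x = 0 \<longleftrightarrow> x = 0"
    proof
      assume 0: "spread_norm n x = 0"
      have "x j = 0" for j
      proof (cases "j \<in> {1..n}")
        case True
        from ell1_norm_le_spread_norm[OF x this] 0 show ?thesis
          using L.norm_nonneg[OF ell1_power_component[OF x True]]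
            L.norm_eq_zero_iff[OF ell1_power_component[OF x True]] by simp
      qed (use x in \<open>auto simp: product_carrier_def\<close>)
      then show "x = 0" by (simp add: fun_eq_iff)
    next
      assume "x = 0"
      then have "spread_norm n x \<le> 0"
        using scale_le[OF x, of 0] by simp
      then show "spread_norm n x = 0" using nonneg[OF x] by simp
    qed
    show "spread_norm n (?s a x) = norm a * spread_norm n x" for a
    proof (cases "a = 0")
      case True
      then show ?thesis using scale_le[OF x, of 0] nonneg[OF scale_P[OF x, of 0]] by simp
    next
      case False
      have "spread_norm n (?s (inverse a) (?s a x)) \<le> norm (inverse a) * spread_norm n (?s a x)"
        by (rule scale_le[OF scale_P[OF x]])
      then have "norm a * spread_norm n x \<le> spread_norm n (?s a x)"
        using False by (simp add: norm_divide field_simps)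
      then show ?thesis using scale_le[OF x, of a] by simp
    qed
    fix y assume y: "y \<in> ?P"
    show "spread_norm n (x + y) \<le> spread_norm n x + spread_norm n y"
      by (rule spread_norm_leI)
         (meson add_mono order_trans spread_seminorm_triangle[OF _ x y]
           spread_seminorm_le_spread_norm[OF _ x] spread_seminorm_le_spread_norm[OF _ y])
  qed
qed

lemma admissible_spread_norm:
  assumes n: "n \<ge> 1"
  shows "admissible_product_norm n (pointwise_scale ((*) :: 'f::real_normed_field \<Rightarrow> 'f \<Rightarrow> 'f))
    (\<lambda>_. ell1) (\<lambda>_. ell1_norm) (spread_norm n)"
  unfolding admissible_product_norm_def
proof (intro conjI ballI normed_space_on_spread_norm[OF n])
  fix x :: "nat \<Rightarrow> nat \<Rightarrow> 'f" assume x: "x \<in> ell1_power n"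
  show "Max ((\<lambda>j. ell1_norm (x j)) ` {1..n}) \<le> spread_norm n x"
    using n ell1_norm_le_spread_norm[OF x] by auto
  show "spread_norm n x \<le> (\<Sum>j=1..n. ell1_norm (x j))"
    by (rule spread_norm_le_sum[OF x])
qed

text \<open>
  The vector with all \<open>n\<close> coordinates equal to the \<open>k\<close>-th unit vector of \<open>\<ell>\<^sub>1\<close>; the coordinates
  outside \<open>{1..n}\<close> vanish, as required of members of the product.
\<close>

definition diagonal_unit :: "nat \<Rightarrow> nat \<Rightarrow> nat \<Rightarrow> nat \<Rightarrow> 'f::real_normed_field" where
  "diagonal_unit n k = (\<lambda>j i. if j \<in> {1..n} \<and> i = k then 1 else 0)"

lemma diagonal_unit_in_ell1_power: "diagonal_unit n k \<in> ell1_power n"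
proof -
  have "summable (\<lambda>i. norm (if i = k then 1 else 0 :: 'a))"
    by (rule summable_finite[of "{k}"]) auto
  then show ?thesis by (auto simp: product_carrier_def diagonal_unit_def ell1_def fun_eq_iff)
qed

lemma spread_norm_diff_diagonal_unit_ge:
  assumes "n \<ge> 1" "k \<noteq> l"
  shows "2 * real n \<le>
    spread_norm n (diagonal_unit n k - diagonal_unit n l :: nat \<Rightarrow> nat \<Rightarrow> 'f::real_normed_field)"
proof -
  let ?x = "diagonal_unit n k - diagonal_unit n l :: nat \<Rightarrow> nat \<Rightarrow> 'f"
  define p :: "(nat \<Rightarrow> nat \<Rightarrow> 'f) \<Rightarrow> real"
    where "p = (\<lambda>x. \<Sum>j=1..n. \<Sum>i\<in>{k, l}. norm (x j i))"
  interpret P: normed_space_on "pointwise_scale (pointwise_scale (*))"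
      "ell1_power n :: (nat \<Rightarrow> nat \<Rightarrow> 'f) set" "spread_norm n"
    by (rule normed_space_on_spread_norm[OF assms(1)])
  have "{k, l} \<in> {A. card A = 2}" using assms(2) by simp
  then have p: "p \<in> spread_seminorms n"
    unfolding p_def spread_seminorms_def by (intro UnI2 image_eqI[OF refl])
  have "2 * real n = p ?x"
    using assms(2) by (simp add: p_def diagonal_unit_def)
  also have "\<dots> \<le> spread_norm n ?x"
    by (rule spread_seminorm_le_spread_norm[OF p])
       (intro P.diff_in_carrier diagonal_unit_in_ell1_power)
  finally show ?thesis .
qed

lemma sum_fun_apply: "(\<Sum>k\<in>A. x k) i = (\<Sum>k\<in>A. x k i)"
  for x :: "'c \<Rightarrow> 'a \<Rightarrow> 'b::comm_monoid_add"
  by (induction A rule: infinite_finite_induct) auto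

text \<open>
  The estimate that keeps functionals small: spreading the mass over \<open>2 n\<close> positions makes the pair
  seminorms no larger than the coordinate norms, both being at most \<open>2 n\<close>.
\<close>

lemma spread_norm_diff_sums_le:
  assumes "finite A" "finite B" "card A = n" "card B = n" "A \<inter> B = {}"
  shows "spread_norm n (sum (diagonal_unit n) A - sum (diagonal_unit n) B
    :: nat \<Rightarrow> nat \<Rightarrow> 'f::real_normed_field) \<le> 2 * real n"
proof (rule spread_norm_leI)
  define y :: "nat \<Rightarrow> nat \<Rightarrow> 'f" where "y = sum (diagonal_unit n) A - sum (diagonal_unit n) B"
  have y_eq: "y j i = (if j \<in> {1..n} then (if i \<in> A then 1 else if i \<in> B then -1 else 0) else 0)"
    for j i
    using assms(1,2,5) by (auto simp: y_def sum_fun_apply diagonal_unit_def split: if_splits)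
  have y_le: "norm (y j i) \<le> 1" for j i by (simp add: y_eq)
  fix p :: "(nat \<Rightarrow> nat \<Rightarrow> 'f) \<Rightarrow> real"
  assume "p \<in> spread_seminorms n"
  then have "p y \<le> 2 * real n"
  proof (cases rule: spread_seminorms_cases)
    case (coordinate j)
    have "ell1_norm (y j) = (\<Sum>i\<in>A \<union> B. norm (y j i))"
      unfolding ell1_norm_def by (rule suminf_finite) (use assms(1,2) in \<open>auto simp: y_eq\<close>)
    also have "\<dots> \<le> (\<Sum>i\<in>A \<union> B. 1)" by (rule sum_mono[OF y_le])
    also have "\<dots> = 2 * real n"
      using assms by (simp add: card_Un_disjoint)
    finally show ?thesis by (simp add: coordinate)
  next
    case (pair C)
    have "(\<Sum>j=1..n. \<Sum>i\<in>C. norm (y j i)) \<le> (\<Sum>j=1..n. \<Sum>i\<in>C. 1)"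
      by (intro sum_mono y_le)
    then show ?thesis using pair by simp
  qed
  then show "p (sum (diagonal_unit n) A - sum (diagonal_unit n) B) \<le> 2 * real n"
    by (simp only: y_def)
qed

text \<open>
  A bounded sequence has two cluster points at distance at least \<open>s\<close> for every \<open>s\<close> below its
  \<open>ca\<close>-value.
\<close>

lemma cluster_points_of_ca:
  fixes u :: "nat \<Rightarrow> 'f::{real_normed_vector, heine_borel}"
  assumes bd: "\<And>k. norm (u k) \<le> D" and s: "s < ca norm u"
  obtains a b where "s \<le> norm (a - b)"
    "\<And>e. e > 0 \<Longrightarrow> infinite {k. norm (u k - a) < e}"
    "\<And>e. e > 0 \<Longrightarrow> infinite {k. norm (u k - b) < e}"
proof -
  have osc: "norm (u k - u l) \<le> 2 * D" for k l
    using norm_triangle_ineq4[of "u k" "u l"] bd[of k] bd[of l] by linarith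
  have "\<exists>k\<ge>i. \<exists>l\<ge>i. s < norm (u k - u l)" for i
    using less_caD[of norm u, OF norm_ge_zero osc s] by metis
  then obtain kk ll where kl: "\<And>i. i \<le> kk i" "\<And>i. i \<le> ll i"
    "\<And>i. s < norm (u (kk i) - u (ll i))"
    by metis
  have "bounded (range u)" using bd by (auto simp: bounded_iff)
  then have "bounded (range u \<times> range u)" by (intro bounded_Times)
  then have "bounded (range (\<lambda>i. (u (kk i), u (ll i))))"
    by (rule bounded_subset) auto
  then obtain ab r where r: "strict_mono (r :: nat \<Rightarrow> nat)"
    and lim: "((\<lambda>i. (u (kk i), u (ll i))) \<circ> r) \<longlonglongrightarrow> ab"
    using bounded_imp_convergent_subsequence by blast
  obtain a b where ab: "ab = (a, b)" by fastforce
  have a: "(\<lambda>i. u (kk (r i))) \<longlonglongrightarrow> a"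
    using tendsto_fst[OF lim] by (simp add: ab o_def)
  have b: "(\<lambda>i. u (ll (r i))) \<longlonglongrightarrow> b"
    using tendsto_snd[OF lim] by (simp add: ab o_def)
  have inf: "infinite {k. norm (u k - c) < e}"
    if c: "(\<lambda>i. u (h (r i))) \<longlonglongrightarrow> c" and h: "\<And>i. i \<le> h i" and e: "e > 0" for c e h
    unfolding infinite_nat_iff_unbounded_le
  proof
    fix m
    obtain i0 where i0: "\<And>i. i0 \<le> i \<Longrightarrow> norm (u (h (r i)) - c) < e"
      using LIMSEQ_D[OF c e] by blast
    have "m \<le> h (r (max i0 m))"
      using h[of "r (max i0 m)"] strict_mono_imp_increasing[OF r, of "max i0 m"] by linarith
    then show "\<exists>k\<ge>m. k \<in> {k. norm (u k - c) < e}"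
      using i0[of "max i0 m"] by auto
  qed
  have "s \<le> norm (a - b)"
    by (rule LIMSEQ_le_const[OF tendsto_norm[OF tendsto_diff[OF a b]]])
       (use kl(3) less_imp_le in blast)
  then show ?thesis
    by (rule that) (rule inf[OF a kl(1)] inf[OF b kl(2)], assumption)+
qed

lemma spread_norm_diagonal_unit_le:
  "spread_norm n (diagonal_unit n k :: nat \<Rightarrow> nat \<Rightarrow> 'f::real_normed_field) \<le> real n"
proof -
  have "ell1_norm (diagonal_unit n k j :: nat \<Rightarrow> 'f) = 1" if "j \<in> {1..n}" for j
  proof -
    have "ell1_norm (diagonal_unit n k j :: nat \<Rightarrow> 'f)
        = (\<Sum>i\<in>{k}. norm (diagonal_unit n k j i :: 'f))"
      unfolding ell1_norm_def by (rule suminf_finite) (auto simp: diagonal_unit_def)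
    then show ?thesis using that by (simp add: diagonal_unit_def)
  qed
  then have sum: "(\<Sum>j=1..n. ell1_norm (diagonal_unit n k j :: nat \<Rightarrow> 'f)) = real n" by simp
  show ?thesis
    using spread_norm_le_sum[OF diagonal_unit_in_ell1_power] unfolding sum[symmetric] .
qed

lemma delta_on_diagonal_unit_le:
  assumes n: "n \<ge> 1"
  shows "delta_on (pointwise_scale (pointwise_scale (*)))
    (ell1_power n :: (nat \<Rightarrow> nat \<Rightarrow> 'f::{real_normed_field, heine_borel}) set)
    (spread_norm n) (diagonal_unit n) \<le> 2"
proof -
  let ?s = "pointwise_scale (pointwise_scale (*)) :: 'f \<Rightarrow> (nat \<Rightarrow> nat \<Rightarrow> 'f) \<Rightarrow> nat \<Rightarrow> nat \<Rightarrow> 'f"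
  let ?P = "ell1_power n :: (nat \<Rightarrow> nat \<Rightarrow> 'f) set"
  let ?x = "diagonal_unit n :: nat \<Rightarrow> nat \<Rightarrow> nat \<Rightarrow> 'f"
  interpret P: normed_space_on ?s ?P "spread_norm n"
    by (rule normed_space_on_spread_norm[OF n])
  have x: "?x k \<in> ?P" for k by (rule diagonal_unit_in_ell1_power)
  show ?thesis
  proof (rule P.delta_on_leI, rule ccontr)
    fix f assume f: "f \<in> dual_ball_on ?s ?P (spread_norm n)"
    define u where "u k = f (?x k)" for k
    assume "\<not> ca norm (\<lambda>k. f (?x k)) \<le> 2"
    then have "2 < ca norm u" by (simp add: u_def[abs_def])
    then obtain s where s: "2 < s" "s < ca norm u" using dense by blast
    define e where "e = (s - 2) / 4"
    have e: "e > 0" using s(1) by (simp add: e_def)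
    have u_le: "norm (u k) \<le> real n" for k
      unfolding u_def
      by (rule order_trans[OF P.dual_ball_on_le[OF f x] spread_norm_diagonal_unit_le])
    obtain a b where ab: "s \<le> norm (a - b)"
      and inf_a: "\<And>e. e > 0 \<Longrightarrow> infinite {k. norm (u k - a) < e}"
      and inf_b: "\<And>e. e > 0 \<Longrightarrow> infinite {k. norm (u k - b) < e}"
      using cluster_points_of_ca[OF u_le s(2)] by blast
    note a = inf_a[OF e] and b = inf_b[OF e]
    obtain A where A: "finite A" "card A = n" "A \<subseteq> {k. norm (u k - a) < e}"
      using infinite_arbitrarily_large[OF a] by blast
    have "infinite ({k. norm (u k - b) < e} - A)" using b A(1) by (rule Diff_infinite_finite[rotated])
    from infinite_arbitrarily_large[OF this, of n]
    obtain B where B: "finite B" "card B = n" "B \<subseteq> {k. norm (u k - b) < e} - A" by blast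
    have near: "norm (sum u C - of_nat n * c) \<le> real n * e"
      if "card C = n" "C \<subseteq> {k. norm (u k - c) < e}" for C c
    proof -
      have "norm (\<Sum>k\<in>C. u k - c) \<le> (\<Sum>k\<in>C. e)"
        by (rule sum_norm_le) (use that(2) in \<open>auto intro: less_imp_le\<close>)
      then show ?thesis using that(1) by (simp add: sum_subtractf)
    qed
    have "f (sum ?x A - sum ?x B) = sum u A - sum u B"
      using P.dual_ball_on_diff[OF f P.sum_in_carrier P.sum_in_carrier, of A ?x B ?x]
        P.dual_ball_on_sum[OF f A(1), of ?x] P.dual_ball_on_sum[OF f B(1), of ?x] x
      by (simp add: u_def)
    then have "norm (sum u A - sum u B) \<le> spread_norm n (sum ?x A - sum ?x B)"
      using P.dual_ball_on_le[OF f P.diff_in_carrier[OF P.sum_in_carrier P.sum_in_carrier], of A ?x B ?x] x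
      by simp
    also have "\<dots> \<le> 2 * real n"
      using A B by (intro spread_norm_diff_sums_le) auto
    finally have fy: "norm (sum u A - sum u B) \<le> 2 * real n" .
    have nearA: "norm (sum u A - of_nat n * a) \<le> real n * e"
      by (rule near[OF A(2,3)])
    have nearB: "norm (sum u B - of_nat n * b) \<le> real n * e"
      by (rule near[OF B(2)]) (use B(3) in blast)
    have eq: "of_nat n * (a - b) =
        (sum u A - sum u B) - (sum u A - of_nat n * a) + (sum u B - of_nat n * b)"
      by (simp add: algebra_simps)
    have "real n * s \<le> norm (of_nat n * (a - b))"
      using ab by (simp add: norm_mult mult_left_mono)
    also have "\<dots> \<le> norm (sum u A - sum u B) + norm (sum u A - of_nat n * a)
        + norm (sum u B - of_nat n * b)"
      unfolding eq by (meson norm_triangle_ineq norm_triangle_ineq4 add_right_mono order_trans)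
    also have "\<dots> \<le> 2 * real n + real n * e + real n * e"
      by (intro add_mono fy nearA nearB)
    also have "\<dots> = real n * (2 + 2 * e)" by (simp add: algebra_simps)
    finally have "s \<le> 2 + 2 * e" using n by simp
    then show False using s(1) by (simp add: e_def field_simps)
  qed
qed

lemma not_schur_property_spread_norm:
  assumes n: "n \<ge> 1" and K: "K < real n"
  shows "\<not> schur_property K (pointwise_scale (pointwise_scale (*)))
    (ell1_power n :: (nat \<Rightarrow> nat \<Rightarrow> 'f::{real_normed_field, heine_borel}) set) (spread_norm n)"
proof
  let ?s = "pointwise_scale (pointwise_scale (*)) :: 'f \<Rightarrow> (nat \<Rightarrow> nat \<Rightarrow> 'f) \<Rightarrow> nat \<Rightarrow> nat \<Rightarrow> 'f"
  let ?P = "ell1_power n :: (nat \<Rightarrow> nat \<Rightarrow> 'f) set"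
  let ?x = "diagonal_unit n :: nat \<Rightarrow> nat \<Rightarrow> nat \<Rightarrow> 'f"
  let ?d = "delta_on ?s ?P (spread_norm n) ?x"
  interpret P: normed_space_on ?s ?P "spread_norm n"
    by (rule normed_space_on_spread_norm[OF n])
  assume schur: "schur_property K ?s ?P (spread_norm n)"
  have bx: "bounded_seq_on ?P (spread_norm n) ?x"
    unfolding bounded_seq_on_def
    using diagonal_unit_in_ell1_power spread_norm_diagonal_unit_le by blast
  obtain D where D: "\<And>k l. 0 \<le> spread_norm n (?x k - ?x l)"
    "\<And>k l. spread_norm n (?x k - ?x l) \<le> 2 * D"
    using P.bounded_seq_osc[OF bx] by metis
  have "2 * real n \<le> ca (spread_norm n) ?x"
  proof (rule ca_geI[of "spread_norm n" ?x, OF D])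
    fix m
    have "2 * real n \<le> spread_norm n (?x m - ?x (Suc m))"
      by (rule spread_norm_diff_diagonal_unit_ge[OF n]) simp
    then show "\<exists>k\<ge>m. \<exists>l\<ge>m. 2 * real n \<le> spread_norm n (?x k - ?x l)"
      using le_SucI[OF order_refl] by blast
  qed
  also have "\<dots> \<le> K * ?d" using schur bx by (simp add: schur_property_def)
  also have "\<dots> < 2 * real n"
  proof (cases "K \<le> 0")
    case True
    then have "K * ?d \<le> 0" using P.delta_on_nonneg[OF bx] by (rule mult_nonpos_nonneg)
    then show ?thesis using n by simp
  next
    case False
    then have "K * ?d \<le> K * 2"
      using delta_on_diagonal_unit_le[OF n] by (intro mult_left_mono) auto
    then show ?thesis using K by linarith
  qed
  finally show False by simp
qed

lemma schur_product_factor_optimal: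
  fixes K :: real
  assumes n: "n \<ge> 1" and K: "K < real n"
  shows "\<exists>(c::real)
      (scale :: 'f::{real_normed_field, banach, heine_borel} \<Rightarrow> (nat \<Rightarrow> 'f) \<Rightarrow> (nat \<Rightarrow> 'f)) V N M.
    c \<ge> 1 \<and>
    (\<forall>j\<in>{1..n}. banach_space_on scale (V j) (N j) \<and> schur_property c scale (V j) (N j)) \<and>
    admissible_product_norm n scale V N M \<and>
    banach_space_on (pointwise_scale scale) (product_carrier n V) M \<and>
    \<not> schur_property (K * c) (pointwise_scale scale) (product_carrier n V) M"
proof (intro exI conjI ballI)
  show "banach_space_on (pointwise_scale (*)) (ell1 :: (nat \<Rightarrow> 'f) set) ell1_norm"
    "schur_property 1 (pointwise_scale (*)) (ell1 :: (nat \<Rightarrow> 'f) set) ell1_norm"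
    by (rule banach_space_on_ell1 schur_property_ell1)+
  show adm: "admissible_product_norm n (pointwise_scale ((*) :: 'f \<Rightarrow> 'f \<Rightarrow> 'f))
      (\<lambda>_. ell1) (\<lambda>_. ell1_norm) (spread_norm n)"
    by (rule admissible_spread_norm[OF n])
  show "banach_space_on (pointwise_scale (pointwise_scale ((*) :: 'f \<Rightarrow> 'f \<Rightarrow> 'f)))
      (ell1_power n) (spread_norm n)"
    by (rule banach_space_product[OF banach_space_on_ell1 adm])
  show "\<not> schur_property (K * 1) (pointwise_scale (pointwise_scale ((*) :: 'f \<Rightarrow> 'f \<Rightarrow> 'f)))
      (ell1_power n) (spread_norm n)"
    using not_schur_property_spread_norm[OF n K] by simp
qed simp

theorem proposition7p3:
  shows "(\<forall>(n::nat) (c::real) (scale :: real \<Rightarrow> 'a::ab_group_add \<Rightarrow> 'a) V N M.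
          n \<ge> 1 \<longrightarrow> c \<ge> 1 \<longrightarrow>
          (\<forall>j\<in>{1..n}. banach_space_on scale (V j) (N j) \<and> schur_property c scale (V j) (N j)) \<longrightarrow>
          admissible_product_norm n scale V N M \<longrightarrow>
          banach_space_on (pointwise_scale scale) (product_carrier n V) M \<and>
          schur_property (real n * c) (pointwise_scale scale) (product_carrier n V) M)
       \<and> (\<forall>(n::nat) (c::real) (scale :: complex \<Rightarrow> 'b::ab_group_add \<Rightarrow> 'b) V N M.
          n \<ge> 1 \<longrightarrow> c \<ge> 1 \<longrightarrow>
          (\<forall>j\<in>{1..n}. banach_space_on scale (V j) (N j) \<and> schur_property c scale (V j) (N j)) \<longrightarrow>
          admissible_product_norm n scale V N M \<longrightarrow>
          banach_space_on (pointwise_scale scale) (product_carrier n V) M \<and>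
          schur_property (real n * c) (pointwise_scale scale) (product_carrier n V) M)
       \<and> (\<forall>(n::nat) (K::real). n \<ge> 1 \<longrightarrow> K < real n \<longrightarrow>
          (\<exists>(c::real) (scale :: real \<Rightarrow> (nat \<Rightarrow> real) \<Rightarrow> (nat \<Rightarrow> real)) V N M.
             c \<ge> 1 \<and>
             (\<forall>j\<in>{1..n}. banach_space_on scale (V j) (N j) \<and> schur_property c scale (V j) (N j)) \<and>
             admissible_product_norm n scale V N M \<and>
             banach_space_on (pointwise_scale scale) (product_carrier n V) M \<and>
             \<not> schur_property (K * c) (pointwise_scale scale) (product_carrier n V) M))
       \<and> (\<forall>(n::nat) (K::real). n \<ge> 1 \<longrightarrow> K < real n \<longrightarrow>
          (\<exists>(c::real) (scale :: complex \<Rightarrow> (nat \<Rightarrow> complex) \<Rightarrow> (nat \<Rightarrow> complex)) V N M.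
             c \<ge> 1 \<and>
             (\<forall>j\<in>{1..n}. banach_space_on scale (V j) (N j) \<and> schur_property c scale (V j) (N j)) \<and>
             admissible_product_norm n scale V N M \<and>
             banach_space_on (pointwise_scale scale) (product_carrier n V) M \<and>
             \<not> schur_property (K * c) (pointwise_scale scale) (product_carrier n V) M))"
proof (intro conjI; intro allI impI)
qed (rule product_of_schur_spaces schur_product_factor_optimal; assumption)+

end
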